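(* Let $m<1$ and $0<\beta<d(1-m)/m$ (so that in particular $m>0$). Then for every $\varepsilon>0$ there exists a probability density $\rho\in\mathcal{P}(\mathbb{R}^d)\cap L^\infty(\mathbb{R}^d)$ such that $$E_\varepsilon(\rho)=\int_{\mathbb{R}^d}\int_{\mathbb{R}^d}\frac{|x-y|^\beta}{\beta}\,d\rho(x)\,d\rho(y)+\varepsilon\int_{\mathbb{R}^d}\frac{\rho^m(x)}{m-1}\,dx=-\infty.$$
   Context: $\mathcal{P}(\mathbb{R}^d)$ is the set of Borel probability measures on $\mathbb{R}^d$; an absolutely continuous measure is identified with its density. The first integral in $E_\varepsilon$ is nonnegative and the second is nonpositive; the value $-\infty$ of the sum means that the first is finite and the second equals $-\infty$. *)

theory Defs
  imports "HOL-Probability.Probability"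
begin

definition prob_density :: "('a::euclidean_space \<Rightarrow> real) \<Rightarrow> bool" where
  "prob_density \<rho> \<longleftrightarrow>
     \<rho> \<in> borel_measurable borel \<and> (\<forall>x. 0 \<le> \<rho> x) \<and> prob_space (density lborel (\<lambda>x. ennreal (\<rho> x)))"

definition essentially_bounded :: "('a::euclidean_space \<Rightarrow> real) \<Rightarrow> bool" where
  "essentially_bounded f \<longleftrightarrow>
     f \<in> borel_measurable borel \<and> esssup lborel (\<lambda>x. ereal \<bar>f x\<bar>) < \<infinity>"

text \<open>The integral of a real function of either sign with values in the extended reals, as the
  integral of the positive part minus that of the negative part. (The Bochner integral would be
  \<open>0\<close> where the value is infinite.)\<close>

definition ext_integral :: "'a measure \<Rightarrow> ('a \<Rightarrow> real) \<Rightarrow> ereal" where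
  "ext_integral M f =
     enn2ereal (\<integral>\<^sup>+x. ennreal (f x) \<partial>M) - enn2ereal (\<integral>\<^sup>+x. ennreal (- f x) \<partial>M)"

text \<open>The coercion \<open>ennreal\<close> truncates negative values to \<open>0\<close>, so this is the interaction energy
  for \<open>\<beta> > 0\<close> only.\<close>

definition interaction_energy :: "real \<Rightarrow> ('a::euclidean_space \<Rightarrow> real) \<Rightarrow> ereal" where
  "interaction_energy \<beta> \<rho> =
     (let \<mu> = density lborel (\<lambda>x. ennreal (\<rho> x))
      in enn2ereal (\<integral>\<^sup>+y. (\<integral>\<^sup>+x. ennreal (norm (x - y) powr \<beta> / \<beta>) \<partial>\<mu>) \<partial>\<mu>))"

definition diffusion_energy :: "real \<Rightarrow> ('a::euclidean_space \<Rightarrow> real) \<Rightarrow> ereal" where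
  "diffusion_energy m \<rho> = ext_integral lborel (\<lambda>x. \<rho> x powr m / (m - 1))"

definition energy :: "real \<Rightarrow> real \<Rightarrow> real \<Rightarrow> ('a::euclidean_space \<Rightarrow> real) \<Rightarrow> ereal" where
  "energy m \<beta> \<epsilon> \<rho> = interaction_energy \<beta> \<rho> + ereal \<epsilon> * diffusion_energy m \<rho>"

text \<open>In \<open>ereal\<close>, \<open>\<infinity> + (-\<infinity>) = \<infinity>\<close>. Hence the value \<open>-\<infinity>\<close> is attained only when the interaction
  energy is finite.\<close>

lemma energy_eq_MInfty_iff:
  assumes "0 < \<epsilon>"
  shows "energy m \<beta> \<epsilon> \<rho> = -\<infinity> \<longleftrightarrow>
    0 \<le> interaction_energy \<beta> \<rho> \<and> interaction_energy \<beta> \<rho> < \<infinity> \<and> diffusion_energy m \<rho> = -\<infinity>"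
proof -
  have "0 \<le> interaction_energy \<beta> \<rho>"
    by (simp add: interaction_energy_def Let_def)
  with assms show ?thesis
    unfolding energy_def
    by (cases "interaction_energy \<beta> \<rho>"; cases "diffusion_energy m \<rho>") auto
qed

end

theory Submission imports Defs begin

text \<open>The density is \<open>\<rho>(x) = c (1 + |x|) powr (- d / m)\<close>: its \<open>m\<close>-th power decays like \<open>|x| powr - d\<close>
  and just fails to be integrable, while \<open>\<beta> < d / m - d\<close> is exactly the condition for a finite
  moment of order \<open>\<beta>\<close>. That moment controls the interaction energy because
  \<open>|x - y| \<le> (1 + |x|) (1 + |y|)\<close>.\<close>

section \<open>Dyadic shells and their volumes\<close>

text \<open>Measuring by \<open>1 + norm x\<close> instead of \<open>norm x\<close> puts the origin
  into shell 0, so natural indices exhaust the space. Powers of \<open>1 + norm x\<close> are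
  constant on a shell up to a fixed factor.\<close>

definition dyadic_shell :: "nat \<Rightarrow> 'a::euclidean_space set" where
  "dyadic_shell k = {x. 2 ^ k \<le> 1 + norm x \<and> 1 + norm x < 2 ^ Suc k}"

lemma dyadic_shell_sets [measurable]: "dyadic_shell k \<in> sets borel"
  unfolding dyadic_shell_def by measurable

lemma disjoint_dyadic_shell: "disjoint_family (dyadic_shell :: nat \<Rightarrow> 'a::euclidean_space set)"
proof -
  have False if "x \<in> dyadic_shell i" "x \<in> dyadic_shell j" "i < j" for i j and x :: 'a
  proof -
    have "(2::real) ^ Suc i \<le> 2 ^ j"
      using that(3) by (intro power_increasing) auto
    with that show False
      unfolding dyadic_shell_def by auto
  qed
  then show ?thesis
    unfolding disjoint_family_on_def by (metis disjoint_iff linorder_neqE_nat)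
qed

lemma ex_dyadic_shell: "\<exists>k. x \<in> dyadic_shell k"
proof -
  have "\<exists>n. 1 + norm x < 2 ^ n"
    using real_arch_pow[of 2] by simp
  \<comment> \<open>The least such exponent is positive because \<open>1 + norm x\<close> is at
    least \<open>2 ^ 0\<close>; hence it has the form \<open>Suc k\<close>.\<close>
  then obtain k where k: "\<And>i. i \<le> k \<Longrightarrow> \<not> 1 + norm x < 2 ^ i" "1 + norm x < 2 ^ Suc k"
    using ex_least_nat_less[of "\<lambda>n. 1 + norm x < 2 ^ n"] by auto
  from k(1)[of k] k(2) have "x \<in> dyadic_shell k"
    unfolding dyadic_shell_def by simp
  then show ?thesis ..
qed

text \<open>The shell lies in the ball of radius \<open>2 ^ Suc k\<close> about the origin. Only the
  growth rate \<open>2 ^ (k * DIM('a))\<close> matters later, so this crude bound suffices.\<close>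

lemma emeasure_dyadic_shell_le:
  "emeasure lborel (dyadic_shell k :: 'a::euclidean_space set)
     \<le> ennreal (unit_ball_vol DIM('a) * 2 ^ DIM('a) * 2 ^ (k * DIM('a)))"
proof -
  have "emeasure lborel (dyadic_shell k :: 'a set) \<le> emeasure lborel (ball (0::'a) (2 ^ Suc k))"
    by (intro emeasure_mono) (auto simp: dyadic_shell_def)
  also have "\<dots> = ennreal (unit_ball_vol DIM('a) * 2 ^ DIM('a) * 2 ^ (k * DIM('a)))"
    by (subst emeasure_ball) (simp_all add: power_mult_distrib power_mult mult.assoc)
  finally show ?thesis .
qed

text \<open>An off-centre ball of radius \<open>2 ^ k / 2\<close> fits inside the shell and already
  has volume of the right order.\<close>

lemma emeasure_dyadic_shell_ge:
  "ennreal (unit_ball_vol DIM('a) / 2 ^ DIM('a) * 2 ^ (k * DIM('a)))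
     \<le> emeasure lborel (dyadic_shell k :: 'a::euclidean_space set)"
proof -
  obtain e :: 'a where e: "e \<in> Basis"
    using nonempty_Basis by blast
  \<comment> \<open>With this centre, \<open>1 + norm c\<close> is the midpoint of the interval from
    \<open>2 ^ k\<close> to \<open>2 ^ Suc k\<close>; by the reverse triangle inequality, a radius
    of half its length keeps the ball in the shell.\<close>
  define c where "c = (3 / 2 * 2 ^ k - 1) *\<^sub>R e"
  have "0 \<le> 3 / 2 * 2 ^ k - (1::real)"
    using one_le_power[of "2::real" k] by linarith
  with e have c: "norm c = 3 / 2 * 2 ^ k - 1"
    unfolding c_def norm_scaleR by (simp only: norm_Basis abs_of_nonneg mult_1_right)
  have "ball c (2 ^ k / 2) \<subseteq> dyadic_shell k"
  proof
    fix x assume "x \<in> ball c (2 ^ k / 2)"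
    then have "\<bar>norm x - norm c\<bar> < 2 ^ k / 2"
      by (metis dist_norm le_less_trans mem_ball norm_minus_commute norm_triangle_ineq3)
    then show "x \<in> dyadic_shell k"
      unfolding dyadic_shell_def c abs_less_iff by simp
  qed
  then have "emeasure lborel (ball c (2 ^ k / 2)) \<le> emeasure lborel (dyadic_shell k :: 'a set)"
    by (intro emeasure_mono) auto
  moreover have "emeasure lborel (ball c (2 ^ k / 2)) =
      ennreal (unit_ball_vol DIM('a) / 2 ^ DIM('a) * 2 ^ (k * DIM('a)))"
    by (subst emeasure_ball) (simp_all add: power_divide power_mult)
  ultimately show ?thesis
    by simp
qed

section \<open>Integrals of powers of \<open>1 + norm x\<close>\<close>

lemma nn_integral_dyadic_shells:
  "(\<integral>\<^sup>+(x::'a::euclidean_space). (\<Sum>k. ennreal (c k) * indicator (dyadic_shell k) x) \<partial>lborel) =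
     (\<Sum>k. ennreal (c k) * emeasure lborel (dyadic_shell k :: 'a set))"
  by (subst nn_integral_suminf) (auto simp: nn_integral_cmult_indicator)

text \<open>On shell \<open>k\<close> the integrand is at most its value at the inner radius,
  \<open>2 powr (- p * k)\<close>, and the volume is of order \<open>2 ^ (k * DIM('a))\<close>. The
  integral is thus dominated by a geometric series whose ratio \<open>q\<close> is below 1.\<close>

lemma nn_integral_one_plus_norm_powr_finite:
  assumes "real DIM('a) < p"
  shows "(\<integral>\<^sup>+(x::'a::euclidean_space). ennreal ((1 + norm x) powr (- p)) \<partial>lborel) < \<infinity>"
proof -
  define q where "q = 2 powr (real DIM('a) - p)"
  define C where "C = unit_ball_vol DIM('a) * 2 ^ DIM('a)"
  have q: "0 \<le> q" "q < 1"
    using assms by (auto simp: q_def powr_less_one)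
  have C: "0 \<le> C"
    by (simp add: C_def)
  have pow: "2 powr (- p * real k) * (C * 2 ^ (k * DIM('a))) = C * q ^ k" for k
    by (simp add: q_def powr_realpow[symmetric] powr_powr powr_add[symmetric] algebra_simps)
  have bound: "ennreal ((1 + norm x) powr (- p))
      \<le> (\<Sum>k. ennreal (2 powr (- p * real k)) * indicator (dyadic_shell k) x)" for x :: 'a
  proof -
    obtain k where k: "x \<in> dyadic_shell k"
      using ex_dyadic_shell by blast
    have "(1 + norm x) powr (- p) \<le> (2 ^ k) powr (- p)"
      using k assms by (intro powr_mono2') (auto simp: dyadic_shell_def)
    also have "\<dots> = 2 powr (- p * real k)"
      by (simp add: powr_realpow[symmetric] powr_powr mult.commute)
    \<comment> \<open>The shells are disjoint, so only the term of the shell containing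
      \<open>x\<close> survives in the series.\<close>
    finally show ?thesis
      by (subst suminf_cmult_indicator[OF disjoint_dyadic_shell k]) (auto intro: ennreal_leI)
  qed
  have "(\<integral>\<^sup>+(x::'a). ennreal ((1 + norm x) powr (- p)) \<partial>lborel)
      \<le> (\<Sum>k. ennreal (2 powr (- p * real k)) * emeasure lborel (dyadic_shell k :: 'a set))"
    unfolding nn_integral_dyadic_shells[symmetric] by (intro nn_integral_mono bound)
  also have "\<dots> \<le> (\<Sum>k. ennreal (C * q ^ k))"
  proof (intro suminf_le)
    fix k
    have "ennreal (2 powr (- p * real k)) * emeasure lborel (dyadic_shell k :: 'a set)
        \<le> ennreal (2 powr (- p * real k)) * ennreal (C * 2 ^ (k * DIM('a)))"
      using emeasure_dyadic_shell_le unfolding C_def by (intro mult_left_mono) auto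
    also have "\<dots> = ennreal (C * q ^ k)"
      using C by (subst ennreal_mult[symmetric]) (simp_all only: pow, auto)
    finally show "ennreal (2 powr (- p * real k)) * emeasure lborel (dyadic_shell k :: 'a set)
        \<le> ennreal (C * q ^ k)" .
  qed auto
  also have "\<dots> < \<infinity>"
    using q C sums_mult[OF geometric_sums, of q C]
    by (subst suminf_ennreal_eq[where x = "C * (1 / (1 - q))"]) auto
  finally show ?thesis .
qed

text \<open>At the critical exponent decay and volume growth cancel: every shell contributes at
  least the same positive constant.\<close>

lemma nn_integral_one_plus_norm_powr_infinite:
  "(\<integral>\<^sup>+(x::'a::euclidean_space). ennreal ((1 + norm x) powr (- real DIM('a))) \<partial>lborel) = \<infinity>"
proof -
  define d where "d = DIM('a)"
  \<comment> \<open>The factor \<open>2 powr (- real d)\<close> is the price of bounding the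
    integrand from below by its value at the outer radius \<open>2 ^ Suc k\<close>.\<close>
  define C where "C = unit_ball_vol d / 2 ^ d * 2 powr (- real d)"
  have C: "0 < C"
    by (simp add: C_def)
  have bound: "(\<Sum>k. ennreal (2 powr (- real d * real (Suc k))) * indicator (dyadic_shell k) x)
      \<le> ennreal ((1 + norm x) powr (- real d))" for x :: 'a
  proof -
    obtain k where k: "x \<in> dyadic_shell k"
      using ex_dyadic_shell by blast
    have "2 powr (- real d * real (Suc k)) = (2 ^ Suc k) powr (- real d)"
      by (simp only: powr_realpow[symmetric] powr_powr mult.commute zero_less_numeral)
    also have "\<dots> \<le> (1 + norm x) powr (- real d)"
      using k by (intro powr_mono2') (auto simp: dyadic_shell_def add_pos_nonneg)
    finally show ?thesis
      by (subst suminf_cmult_indicator[OF disjoint_dyadic_shell k]) (auto intro: ennreal_leI)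
  qed
  have "\<not> summable (\<lambda>_::nat. C)"
    using C by (simp add: summable_const_iff)
  then have "\<infinity> = (\<Sum>k::nat. ennreal C)"
    using summable_suminf_not_top[of "\<lambda>_. C"] less_imp_le[OF C] unfolding infinity_ennreal_def
    by metis
  also have "\<dots> \<le> (\<Sum>k. ennreal (2 powr (- real d * real (Suc k)))
      * emeasure lborel (dyadic_shell k :: 'a set))"
  proof (intro suminf_le)
    fix k
    have "C = 2 powr (- real d * real (Suc k)) * (unit_ball_vol d / 2 ^ d * 2 ^ (k * d))"
      by (simp add: C_def powr_realpow[symmetric] powr_powr powr_add[symmetric] algebra_simps)
    then have "ennreal C = ennreal (2 powr (- real d * real (Suc k)))
        * ennreal (unit_ball_vol d / 2 ^ d * 2 ^ (k * d))"
      by (simp add: ennreal_mult[symmetric])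
    also have "\<dots> \<le> ennreal (2 powr (- real d * real (Suc k)))
        * emeasure lborel (dyadic_shell k :: 'a set)"
      using emeasure_dyadic_shell_ge unfolding d_def by (intro mult_left_mono) auto
    finally show "ennreal C \<le> \<dots>" .
  qed auto
  also have "\<dots> \<le> (\<integral>\<^sup>+(x::'a). ennreal ((1 + norm x) powr (- real d)) \<partial>lborel)"
    unfolding nn_integral_dyadic_shells[symmetric] by (intro nn_integral_mono bound)
  finally show ?thesis
    unfolding d_def by (simp add: top_unique)
qed

section \<open>Finite interaction energy and infinite diffusion energy\<close>

lemma interaction_energy_finite:
  fixes \<rho> :: "'a::euclidean_space \<Rightarrow> real"
  assumes \<beta>: "0 < \<beta>" and [measurable]: "\<rho> \<in> borel_measurable borel"
    and moment: "(\<integral>\<^sup>+x. ennreal ((1 + norm x) powr \<beta>)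
      \<partial>density lborel (\<lambda>x. ennreal (\<rho> x))) < \<infinity>"
  shows "interaction_energy \<beta> \<rho> < \<infinity>"
proof -
  define \<mu> where "\<mu> = density lborel (\<lambda>x. ennreal (\<rho> x))"
  have [measurable_cong, simp]: "sets \<mu> = sets borel"
    by (simp add: \<mu>_def)
  define M where "M = (\<integral>\<^sup>+x. ennreal ((1 + norm x) powr \<beta>) \<partial>\<mu>)"
  have "norm (x - y) powr \<beta> / \<beta>
      \<le> (1 + norm y) powr \<beta> / \<beta> * (1 + norm x) powr \<beta>" for x y :: 'a
  proof -
    have "norm (x - y) \<le> norm x + norm y"
      by (rule norm_triangle_ineq4)
    \<comment> \<open>The two sides differ by \<open>1 + norm x * norm y\<close>.\<close>
    also have "\<dots> \<le> (1 + norm y) * (1 + norm x)"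
      by (simp add: algebra_simps)
    finally have "norm (x - y) powr \<beta> \<le> ((1 + norm y) * (1 + norm x)) powr \<beta>"
      using \<beta> by (intro powr_mono2) auto
    then show ?thesis
      using \<beta> by (simp add: powr_mult divide_right_mono)
  qed
  \<comment> \<open>The bound separates the variables, so the double integral is at most the square
    of the moment \<open>M\<close>, divided by \<open>\<beta>\<close>.\<close>
  then have "(\<integral>\<^sup>+y. (\<integral>\<^sup>+x. ennreal (norm (x - y) powr \<beta> / \<beta>) \<partial>\<mu>) \<partial>\<mu>)
      \<le> (\<integral>\<^sup>+y. (\<integral>\<^sup>+x. ennreal ((1 + norm y) powr \<beta> / \<beta>) * ennreal ((1 + norm x) powr \<beta>) \<partial>\<mu>) \<partial>\<mu>)"
    using \<beta> by (intro nn_integral_mono) (auto simp: ennreal_mult[symmetric] intro!: ennreal_leI)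
  also have "\<dots> = (\<integral>\<^sup>+y. ennreal (1 / \<beta>) * ennreal ((1 + norm y) powr \<beta>) * M \<partial>\<mu>)"
    using \<beta> unfolding M_def
    by (subst nn_integral_cmult) (auto simp: ennreal_mult[symmetric] intro!: nn_integral_cong)
  also have "\<dots> = ennreal (1 / \<beta>) * M * M"
    unfolding M_def by (subst nn_integral_multc, simp, subst nn_integral_cmult) auto
  also have "\<dots> < \<infinity>"
    using moment unfolding M_def \<mu>_def by (simp add: ennreal_mult_less_top)
  finally show ?thesis
    unfolding interaction_energy_def Let_def \<mu>_def
    by (simp add: less_top[symmetric])
qed

text \<open>As \<open>m - 1\<close> is negative, the integrand has no positive part. The extended
  integral is therefore \<open>0 - \<infinity>\<close> and not the ambiguous
  \<open>\<infinity> - \<infinity>\<close>.\<close>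

lemma diffusion_energy_eq_MInfty:
  assumes m: "m < 1"
    and inf: "(\<integral>\<^sup>+x. ennreal (\<rho> x powr m) \<partial>lborel) = \<infinity>"
    and [measurable]: "\<rho> \<in> borel_measurable borel"
  shows "diffusion_energy m \<rho> = -\<infinity>"
proof -
  have "(\<integral>\<^sup>+x. ennreal (\<rho> x powr m / (m - 1)) \<partial>lborel) = 0"
    using m by (subst nn_integral_cong[where v = "\<lambda>_. 0"])
      (auto intro!: ennreal_neg divide_nonneg_neg)
  moreover have "(\<integral>\<^sup>+x. ennreal (- (\<rho> x powr m / (m - 1))) \<partial>lborel)
      = (\<integral>\<^sup>+x. ennreal (1 / (1 - m)) * ennreal (\<rho> x powr m) \<partial>lborel)"
    using m by (intro nn_integral_cong) (simp add: ennreal_mult[symmetric] field_simps)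
  moreover have "\<dots> = \<infinity>"
    using m inf by (subst nn_integral_cmult) (auto simp: ennreal_mult_eq_top_iff)
  ultimately show ?thesis
    unfolding diffusion_energy_def ext_integral_def by (simp add: zero_ennreal.rep_eq)
qed

section \<open>The normalised density and its energy\<close>

theorem theorem4p3:
  fixes m \<beta> \<epsilon> :: real
  assumes "m < 1"
    and "0 < \<beta>" and "\<beta> < real CARD('d) * (1 - m) / m"
    and "0 < \<epsilon>"
  shows "\<exists>\<rho> :: real ^ 'd::finite \<Rightarrow> real.
    prob_density \<rho> \<and> essentially_bounded \<rho> \<and> energy m \<beta> \<epsilon> \<rho> = -\<infinity>"
proof -
  define d where "d = real DIM(real ^ 'd)"
  have d: "d = real CARD('d)" "0 < d"
    by (simp_all add: d_def)
  have m: "0 < m"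
  proof (rule ccontr)
    \<comment> \<open>For \<open>m \<le> 0\<close> the upper bound on \<open>\<beta>\<close> would
      not be positive; this covers \<open>m = 0\<close>, where the quotient is 0 by
      convention.\<close>
    assume "\<not> 0 < m"
    then have "d * (1 - m) / m \<le> 0"
      using d \<open>m < 1\<close> by (intro divide_nonneg_nonpos) auto
    with assms d show False
      by simp
  qed
  \<comment> \<open>This is used twice: \<open>d < d / m\<close> makes the profile integrable, and
    \<open>d < d / m - \<beta>\<close> makes its moment of order \<open>\<beta>\<close>
    finite.\<close>
  have s: "d + \<beta> < d / m"
    using assms(3) m unfolding d(1)[symmetric] by (simp add: field_simps)
  let ?w = "\<lambda>x :: real ^ 'd. (1 + norm x) powr (- (d / m))"
  define J where "J = (\<integral>\<^sup>+x. ennreal (?w x) \<partial>lborel)"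
  have J_fin: "J < \<infinity>"
    unfolding J_def using s \<open>0 < \<beta>\<close>
    by (intro nn_integral_one_plus_norm_powr_finite) (simp add: d_def)
  \<comment> \<open>If \<open>J\<close> vanished, the everywhere positive profile would be zero
    almost everywhere, and the whole space would be a null set.\<close>
  have "J \<noteq> 0"
  proof
    assume "J = 0"
    then have "AE x in lborel :: (real ^ 'd) measure. ennreal (?w x) = 0"
      unfolding J_def by (subst (asm) nn_integral_0_iff_AE) auto
    then have "AE x in lborel :: (real ^ 'd) measure. False"
    proof eventually_elim
      case (elim x)
      moreover have "0 < 1 + norm x"
        by (simp add: add_pos_nonneg)
      ultimately show False
        by (simp add: ennreal_eq_0_iff powr_def)
    qed
    then show False
      by (simp add: AE_iff_null null_sets_def)
  qed
  \<comment> \<open>The normalising constant. Since \<open>J\<close> is neither 0 nor infinite,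
    neither \<open>enn2real\<close> nor the division falls back to its default value 0.\<close>
  define c where "c = 1 / enn2real J"
  have J_pos: "0 < enn2real J"
    using J_fin \<open>J \<noteq> 0\<close> by (simp add: enn2real_positive_iff zero_less_iff_neq_zero)
  then have c: "0 < c"
    by (simp add: c_def)
  have cJ: "ennreal c * J = 1"
  proof -
    have "J = ennreal (enn2real J)"
      using J_fin by simp
    then have "ennreal c * J = ennreal (c * enn2real J)"
      using c by (metis ennreal_mult' less_imp_le)
    then show ?thesis
      using J_pos by (simp add: c_def)
  qed
  define \<rho> where "\<rho> = (\<lambda>x. c * ?w x)"
  have [measurable]: "\<rho> \<in> borel_measurable borel"
    unfolding \<rho>_def by measurable
  have nonneg: "0 \<le> \<rho> x" for x
    using c by (simp add: \<rho>_def)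
  have ennreal_\<rho>: "ennreal (\<rho> x) = ennreal c * ennreal (?w x)" for x
    using c by (simp add: \<rho>_def ennreal_mult)
  have "prob_density \<rho>"
    unfolding prob_density_def
  proof (intro conjI allI nonneg prob_spaceI)
    have "emeasure (density lborel (\<lambda>x. ennreal (\<rho> x))) UNIV = ennreal c * J"
      unfolding J_def ennreal_\<rho> by (subst emeasure_density) (auto simp: nn_integral_cmult)
    with cJ show "emeasure (density lborel (\<lambda>x. ennreal (\<rho> x)))
        (space (density lborel (\<lambda>x. ennreal (\<rho> x)))) = 1"
      by simp
  qed measurable
  moreover have "essentially_bounded \<rho>"
    unfolding essentially_bounded_def
  proof
    have "?w x \<le> 1" for x
      using d m powr_mono2'[of "- (d / m)" 1 "1 + norm x"] by simp
    then have "\<bar>\<rho> x\<bar> \<le> c" for x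
      using c by (simp add: \<rho>_def mult_left_le abs_mult)
    then have "esssup lborel (\<lambda>x. ereal \<bar>\<rho> x\<bar>) \<le> ereal c"
      by (intro esssup_I) auto
    then show "esssup lborel (\<lambda>x. ereal \<bar>\<rho> x\<bar>) < \<infinity>"
      by auto
  qed measurable
  moreover have "interaction_energy \<beta> \<rho> < \<infinity>"
  proof (rule interaction_energy_finite)
    \<comment> \<open>The weight raises the exponent of the profile to
      \<open>- (d / m - \<beta>)\<close>, which by \<open>s\<close> still decays faster than the
      critical power \<open>- d\<close>.\<close>
    have "(\<integral>\<^sup>+x. ennreal ((1 + norm x) powr \<beta>) \<partial>density lborel (\<lambda>x. ennreal (\<rho> x)))
        = (\<integral>\<^sup>+(x::real^'d). ennreal c * ennreal ((1 + norm x) powr (- (d / m - \<beta>))) \<partial>lborel)"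
      using c by (subst nn_integral_density)
        (auto simp: \<rho>_def ennreal_mult[symmetric] powr_add[symmetric] intro!: nn_integral_cong)
    also have "\<dots> = ennreal c
        * (\<integral>\<^sup>+(x::real^'d). ennreal ((1 + norm x) powr (- (d / m - \<beta>))) \<partial>lborel)"
      by (rule nn_integral_cmult) measurable
    also have "\<dots> < \<infinity>"
      using s nn_integral_one_plus_norm_powr_finite[where 'a = "real ^ 'd", of "d / m - \<beta>"]
      by (simp add: d_def ennreal_mult_less_top)
    finally show "(\<integral>\<^sup>+x. ennreal ((1 + norm x) powr \<beta>) \<partial>density lborel (\<lambda>x. ennreal (\<rho> x))) < \<infinity>" .
  qed (use \<open>0 < \<beta>\<close> in measurable)
  moreover have "diffusion_energy m \<rho> = -\<infinity>"
  proof (rule diffusion_energy_eq_MInfty[OF \<open>m < 1\<close>])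
    \<comment> \<open>Raising to the power \<open>m\<close> turns the exponent
      \<open>- (d / m)\<close> into exactly the critical \<open>- d\<close>.\<close>
    have "(\<integral>\<^sup>+x. ennreal (\<rho> x powr m) \<partial>lborel)
        = (\<integral>\<^sup>+(x::real^'d). ennreal (c powr m) * ennreal ((1 + norm x) powr (- d)) \<partial>lborel)"
      using c m
      by (intro nn_integral_cong) (simp add: \<rho>_def ennreal_mult[symmetric] powr_mult powr_powr)
    also have "\<dots> = \<infinity>"
      using c nn_integral_one_plus_norm_powr_infinite[where 'a = "real ^ 'd"]
      by (subst nn_integral_cmult) (auto simp: d_def ennreal_mult_eq_top_iff)
    finally show "(\<integral>\<^sup>+x. ennreal (\<rho> x powr m) \<partial>lborel) = \<infinity>" .
  qed measurable
  ultimately show ?thesis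
    using energy_eq_MInfty_iff[OF \<open>0 < \<epsilon>\<close>, of m \<beta> \<rho>]
    by (auto simp: interaction_energy_def Let_def)
qed

end
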